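(* Let $\mathbf{G}\in\mathbb{C}^{L_R\times N_R}$ have full row rank $L_R$ and let $\mathcal{S}:=\operatorname{row}(\mathbf{G})$. Then: (i) $\mathbf{J}_{\mathrm{MiLAC}}(\boldsymbol{\xi};\mathbf{G})\preceq\mathbf{J}_{\mathrm{dig}}(\boldsymbol{\xi})$ in the Löwner order. (ii) Whenever the marginalized $\boldsymbol{\theta}$-block Fisher information matrices of both $\mathbf{J}_{\mathrm{MiLAC}}(\boldsymbol{\xi};\mathbf{G})$ and $\mathbf{J}_{\mathrm{dig}}(\boldsymbol{\xi})$ are positive definite, $\mathrm{CRB}_{\mathrm{MiLAC}}(\boldsymbol{\theta};\mathbf{G})\succeq\mathrm{CRB}_{\mathrm{dig}}(\boldsymbol{\theta})$ in the Löwner order on $K\times K$ matrices. (iii) $\mathbf{J}_{\mathrm{MiLAC}}(\boldsymbol{\xi};\mathbf{G})=\mathbf{J}_{\mathrm{dig}}(\boldsymbol{\xi})$ (as $3K\times3K$ matrices) if and only if $\mathcal{S}\supseteq\mathcal{S}_K^\star(\boldsymbol{\theta})$, where $\mathcal{S}_K^\star(\boldsymbol{\theta}):=\operatorname{span}_{\mathbb{C}}\{\mathbf{a}(\theta_k),\dot{\mathbf{a}}(\theta_k)\}_{k=1}^K$.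
   Context: $K,T\ge1$, $1\le L_R\le N_R$. $\mathbf{a}:\mathbb{R}\to\mathbb{C}^{N_R}$ is a differentiable steering-vector function with derivative $\dot{\mathbf{a}}$; $\theta_1,\dots,\theta_K\in\mathbb{R}$ are distinct, $\boldsymbol\theta=[\theta_1,\dots,\theta_K]^{\mathsf T}$; $\beta_1,\dots,\beta_K\in\mathbb{C}\setminus\{0\}$; $\mathbf{s}=(s_1,\dots,s_T)\in\mathbb{C}^T$ is a known nonzero waveform; $\sigma^2>0$. Standing non-degeneracy assumption: $2K\le N_R$ and $\dim_{\mathbb{C}}\mathcal{S}_K^\star(\boldsymbol{\theta})=2K$. The real parameter vector is $\boldsymbol{\xi}=[\theta_1,\dots,\theta_K,\Re\beta_1,\Im\beta_1,\dots,\Re\beta_K,\Im\beta_K]^{\mathsf T}\in\mathbb{R}^{3K}$. Let $\boldsymbol{\mu}_t=s_t\sum_{k}\beta_k\mathbf{a}(\theta_k)$, so $\partial_{\theta_k}\boldsymbol{\mu}_t=s_t\beta_k\dot{\mathbf{a}}(\theta_k)$, $\partial_{\Re\beta_k}\boldsymbol{\mu}_t=s_t\mathbf{a}(\theta_k)$, $\partial_{\Im\beta_k}\boldsymbol{\mu}_t=js_t\mathbf{a}(\theta_k)$. Let $\mathcal{J}_{\mathrm{dig}}\in\mathbb{C}^{TN_R\times3K}$ be the vertical stack over $t$ of $\partial\boldsymbol{\mu}_t/\partial\boldsymbol{\xi}$. Define $\mathbf{J}_{\mathrm{dig}}(\boldsymbol{\xi})=\frac{2}{\sigma^2}\Re\{\mathcal{J}_{\mathrm{dig}}^{\mathsf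 H}\mathcal{J}_{\mathrm{dig}}\}$ and, for full-row-rank $\mathbf{G}$, $$\mathbf{J}_{\mathrm{MiLAC}}(\boldsymbol{\xi};\mathbf{G})=\frac{2}{\sigma^2}\Re\bigl\{\mathcal{J}_{\mathrm{dig}}^{\mathsf H}\bigl(\mathbf{I}_T\otimes\mathbf{G}^{\mathsf H}(\mathbf{G}\mathbf{G}^{\mathsf H})^{-1}\mathbf{G}\bigr)\mathcal{J}_{\mathrm{dig}}\bigr\}.$$ These are the Fisher information matrices about $\boldsymbol{\xi}$ in the observations $\boldsymbol{\mu}_t+\mathbf{n}_t$ and $\mathbf{G}(\boldsymbol{\mu}_t+\mathbf{n}_t)$ respectively, with $\mathbf{n}_t\sim\mathcal{CN}(\mathbf{0},\sigma^2\mathbf{I}_{N_R})$ independent over $t$. For a $3K\times3K$ information matrix $\mathbf{J}$ partitioned into angle block $\mathbf{J}_{\theta\theta}$ ($K\times K$), amplitude block $\mathbf{J}_{\beta\beta}$ ($2K\times2K$) and cross blocks, the marginalized $\boldsymbol{\theta}$-block is the Schur complement $\mathbf{J}_{\theta\theta}-\mathbf{J}_{\theta\beta}\mathbf{J}_{\beta\beta}^{-1}\mathbf{J}_{\beta\theta}$ (with $\mathbf{J}_{\beta\beta}$ invertible), and the corresponding $\mathrm{CRB}(\boldsymbol{\theta})$ is its inverse. Conventions: $\operatorname{row}(\mathbf{G}):=\operatorname{col}(\mathbf{G}^{\mathsf H})$; $\mathbf{A}\preceq\mathbf{B}$ means $\mathbf{B}-\mathbf{A}$ is positive semidefinite. 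*)

theory Defs
  imports "HOL-Analysis.Analysis"
begin

section \<open>Matrices\<close>

definition adjoint_matrix :: "complex^'n^'m \<Rightarrow> complex^'m^'n" where
  "adjoint_matrix A = map_matrix cnj (transpose A)"

definition col_space :: "complex^'n^'m \<Rightarrow> (complex^'m) set" where
  "col_space A = vec.span (columns A)"

text \<open>The row space is the column space of the conjugate transpose, so it is spanned by the
  conjugated rows and not by the rows themselves.\<close>

definition row_space :: "complex^'n^'m \<Rightarrow> (complex^'n) set" where
  "row_space A = col_space (adjoint_matrix A)"

definition kronecker_product ::
  "'a::times^'n^'m \<Rightarrow> 'a^'q^'p \<Rightarrow> 'a^('n \<times> 'q)^('m \<times> 'p)" where
  "kronecker_product A B = (\<chi> i j. A $ fst i $ fst j * B $ snd i $ snd j)"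

definition pos_semidef :: "real^'n^'n \<Rightarrow> bool" where
  "pos_semidef A \<longleftrightarrow> transpose A = A \<and> (\<forall>x. 0 \<le> x \<bullet> (A *v x))"

definition pos_def :: "real^'n^'n \<Rightarrow> bool" where
  "pos_def A \<longleftrightarrow> transpose A = A \<and> (\<forall>x. x \<noteq> 0 \<longrightarrow> 0 < x \<bullet> (A *v x))"

definition loewner_le :: "real^'n^'n \<Rightarrow> real^'n^'n \<Rightarrow> bool" where
  "loewner_le A B \<longleftrightarrow> pos_semidef (B - A)"


section \<open>Parameters and signal model\<close>

text \<open>The index types \<open>'k\<close>, \<open>'t\<close>, \<open>'n\<close>, \<open>'l\<close> stand for the $K$ targets, the $T$ snapshots, the
  $N_R$ antennas and the $L_R$ outputs. The real parameter vector has the coordinate \<open>Inl k\<close> for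
  the angle $\theta_k$, and \<open>Inr (k, False)\<close>, \<open>Inr (k, True)\<close> for the real and imaginary part
  of the amplitude $\beta_k$.\<close>

type_synonym 'k param = "'k + 'k \<times> bool"

definition param_vector :: "real^'k \<Rightarrow> complex^'k \<Rightarrow> real^('k::finite) param" where
  "param_vector \<theta> \<beta> = (\<chi> p. case p of
     Inl k \<Rightarrow> \<theta> $ k
   | Inr (k, im) \<Rightarrow> (if im then Im (\<beta> $ k) else Re (\<beta> $ k)))"

definition angle :: "real^('k::finite) param \<Rightarrow> 'k \<Rightarrow> real" where
  "angle \<xi> k = \<xi> $ Inl k"

definition amplitude :: "real^('k::finite) param \<Rightarrow> 'k \<Rightarrow> complex" where
  "amplitude \<xi> k = Complex (\<xi> $ Inr (k, False)) (\<xi> $ Inr (k, True))"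

definition signal_mean ::
  "(real \<Rightarrow> complex^'n) \<Rightarrow> complex^'t \<Rightarrow> real^('k::finite) param \<Rightarrow> 't \<Rightarrow> complex^'n" where
  "signal_mean a s \<xi> t = s $ t *s (\<Sum>k\<in>UNIV. amplitude \<xi> k *s a (angle \<xi> k))"

text \<open>The column at \<open>p\<close> is the partial derivative with respect to the real parameter \<open>p\<close>; the
  row index \<open>(t, i)\<close> is entry \<open>i\<close> of snapshot \<open>t\<close> in the vertical stack.\<close>

definition stacked_jacobian ::
  "(real \<Rightarrow> complex^'n) \<Rightarrow> complex^'t \<Rightarrow> real^'k param
     \<Rightarrow> complex^('k::finite) param^('t \<times> 'n)" where
  "stacked_jacobian a s \<xi> = (\<chi> q p.
     vector_derivative (\<lambda>h. signal_mean a s (\<xi> + h *\<^sub>R axis p 1) (fst q)) (at 0) $ snd q)"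

lemma angle_param_vector_shift: "angle (param_vector \<theta> \<beta> + h *\<^sub>R axis p 1) k = \<theta> $ k + (if p = Inl k then h else 0)"
  by (auto simp: angle_def param_vector_def axis_def)
lemma amplitude_param_vector_shift: "amplitude (param_vector \<theta> \<beta> + h *\<^sub>R axis p 1) k = \<beta> $ k + (if p = Inr (k,False) then of_real h else if p = Inr (k,True) then \<i> * of_real h else 0)"
  by (auto simp: amplitude_def param_vector_def axis_def complex_eq_iff)

lemma bounded_linear_vector_smult: "bounded_linear (\<lambda>x::complex^'n. c *s x)"
  by (rule linear_conv_bounded_linear[THEN iffD1], rule linearI) (auto simp: vec_eq_iff algebra_simps)

lemma stacked_jacobian_angle:
  fixes a :: "real \<Rightarrow> complex^'n"
  assumes "\<And>x. a differentiable (at x)"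
  shows "stacked_jacobian a s (param_vector \<theta> \<beta>) $ (t,i) $ Inl k = s $ t * \<beta> $ k * vector_derivative a (at (\<theta> $ k)) $ i"
proof -
  have 1: "signal_mean a s (param_vector \<theta> \<beta> + h *\<^sub>R axis (Inl k) 1) t
     = (s $ t * \<beta> $ k) *s a (\<theta> $ k + h) + s $ t *s (\<Sum>l\<in>UNIV-{k}. \<beta> $ l *s a (\<theta> $ l))" for h
    unfolding signal_mean_def angle_param_vector_shift amplitude_param_vector_shift
    by (subst sum.remove[of _ k]) (auto simp: vec.scale_right_distrib intro!: arg_cong2[where f="(*s)"] sum.cong)
  have d: "(a has_vector_derivative vector_derivative a (at (\<theta> $ k))) (at (\<theta> $ k))"
    using assms vector_derivative_works by blast
  have d2: "((\<lambda>h. a (\<theta> $ k + h)) has_vector_derivative vector_derivative a (at (\<theta> $ k))) (at 0)"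
  proof -
    have "((\<lambda>h. \<theta> $ k + h) has_vector_derivative 1) (at 0)"
      by (auto intro!: derivative_eq_intros)
    then show ?thesis
    using vector_diff_chain_at[of "\<lambda>h. \<theta> $ k + h" 1 0 a "vector_derivative a (at (\<theta> $ k))"] d
    by (simp add: o_def)
  qed
  have d3: "((\<lambda>h. (s $ t * \<beta> $ k) *s a (\<theta> $ k + h) + s $ t *s (\<Sum>l\<in>UNIV-{k}. \<beta> $ l *s a (\<theta> $ l))) has_vector_derivative (s $ t * \<beta> $ k) *s vector_derivative a (at (\<theta> $ k))) (at 0)"
    using has_vector_derivative_add[OF bounded_linear.has_vector_derivative[OF bounded_linear_vector_smult d2] has_vector_derivative_const] by simp
  show ?thesis
    unfolding stacked_jacobian_def 
    by (simp only: vec_lambda_beta fst_conv snd_conv 1 vector_derivative_at[OF d3] vector_smult_component)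
qed

lemma stacked_jacobian_amplitude:
  fixes a :: "real \<Rightarrow> complex^'n"
  shows "stacked_jacobian a s (param_vector \<theta> \<beta>) $ (t,i) $ Inr (k,b) = (if b then \<i> else 1) * s $ t * a (\<theta> $ k) $ i"
proof -
  have 1: "signal_mean a s (param_vector \<theta> \<beta> + h *\<^sub>R axis (Inr (k,b)) 1) t
     = h *\<^sub>R (((if b then \<i> else 1) * s $ t) *s a (\<theta> $ k)) + s $ t *s (\<Sum>l\<in>UNIV. \<beta> $ l *s a (\<theta> $ l))" for h
    unfolding signal_mean_def angle_param_vector_shift amplitude_param_vector_shift
    apply (subst sum.remove[of _ k], simp, simp)
    apply (subst (2) sum.remove[of _ k], simp, simp)
    apply (auto simp: vec_eq_iff algebra_simps scaleR_conv_of_real[where 'a=complex] intro!: sum.cong)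
    done
  have "((\<lambda>h. h *\<^sub>R (((if b then \<i> else 1) * s $ t) *s a (\<theta> $ k)) + s $ t *s (\<Sum>l\<in>UNIV. \<beta> $ l *s a (\<theta> $ l))) has_vector_derivative ((if b then \<i> else 1) * s $ t) *s a (\<theta> $ k)) (at 0)"
    by (auto intro!: derivative_eq_intros)
  then show ?thesis
    unfolding stacked_jacobian_def by (simp only: vec_lambda_beta fst_conv snd_conv 1 vector_derivative_at vector_smult_component)
qed

definition signal_subspace ::
  "(real \<Rightarrow> complex^'n) \<Rightarrow> real^'k \<Rightarrow> (complex^'n) set" where
  "signal_subspace a \<theta> =
     vec.span (\<Union>k. {a (\<theta> $ k), vector_derivative a (at (\<theta> $ k))})"


section \<open>Fisher information and Cramer-Rao bound\<close>

definition fisher_dig ::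
  "(real \<Rightarrow> complex^'n) \<Rightarrow> complex^'t \<Rightarrow> real \<Rightarrow> real^'k param
     \<Rightarrow> real^('k::finite) param^'k param" where
  "fisher_dig a s \<sigma> \<xi> = (2 / \<sigma>\<^sup>2) *\<^sub>R map_matrix Re
     (adjoint_matrix (stacked_jacobian a s \<xi>) ** stacked_jacobian a s \<xi>)"

definition fisher_milac ::
  "(real \<Rightarrow> complex^'n) \<Rightarrow> complex^'t \<Rightarrow> real \<Rightarrow> complex^'n^'l \<Rightarrow> real^'k param
     \<Rightarrow> real^('k::finite) param^'k param" where
  "fisher_milac a s \<sigma> G \<xi> = (2 / \<sigma>\<^sup>2) *\<^sub>R map_matrix Re
     (adjoint_matrix (stacked_jacobian a s \<xi>)
        ** kronecker_product (mat 1)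
             (adjoint_matrix G ** matrix_inv (G ** adjoint_matrix G) ** G)
        ** stacked_jacobian a s \<xi>)"

definition block_\<theta>\<theta> :: "real^('k::finite) param^'k param \<Rightarrow> real^'k^'k" where
  "block_\<theta>\<theta> J = (\<chi> i j. J $ Inl i $ Inl j)"

definition block_\<theta>\<beta> :: "real^('k::finite) param^'k param \<Rightarrow> real^('k \<times> bool)^'k" where
  "block_\<theta>\<beta> J = (\<chi> i j. J $ Inl i $ Inr j)"

definition block_\<beta>\<theta> :: "real^('k::finite) param^'k param \<Rightarrow> real^'k^('k \<times> bool)" where
  "block_\<beta>\<theta> J = (\<chi> i j. J $ Inr i $ Inl j)"

definition block_\<beta>\<beta> :: "real^('k::finite) param^'k param \<Rightarrow> real^('k \<times> bool)^('k \<times> bool)" where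
  "block_\<beta>\<beta> J = (\<chi> i j. J $ Inr i $ Inr j)"

text \<open>Meaningful only if \<open>block_\<beta>\<beta> J\<close> is invertible; otherwise \<open>matrix_inv\<close> is an unspecified
  matrix.\<close>

definition marginal_fisher :: "real^('k::finite) param^'k param \<Rightarrow> real^'k^'k" where
  "marginal_fisher J = block_\<theta>\<theta> J - block_\<theta>\<beta> J ** matrix_inv (block_\<beta>\<beta> J) ** block_\<beta>\<theta> J"

definition crb :: "real^('k::finite) param^'k param \<Rightarrow> real^'k^'k" where
  "crb J = matrix_inv (marginal_fisher J)"

end

theory Submission
  imports Defs
begin

text \<open>On real vectors \<open>x\<close> the information matrices are the quadratic forms \<open>c * norm (M x)^2\<close> and
  \<open>c * norm (W (M x))^2\<close>, where \<open>M\<close> is the stacked Jacobian, \<open>c = 2 / \<sigma>\<^sup>2\<close>, and \<open>W = I \<otimes> P\<close> with \<open>P\<close>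
  the orthogonal projection onto the row space of \<open>G\<close>. Their difference is \<open>c * norm (M x - W (M x))^2\<close>:
  it is nonnegative, and it vanishes identically iff \<open>P\<close> fixes all columns of \<open>M\<close> blockwise. A Schur
  complement is the minimum of the quadratic form over the eliminated coordinates, hence monotone in
  the Loewner order, and inversion of positive definite matrices is antitone.\<close>

section \<open>Real quadratic forms and Schur complements\<close>

text \<open>The information matrices are handled only through their bilinear forms, so symmetry is
  read off there. The converse direction is nondegeneracy of the inner product.\<close>

lemma transpose_eq_iff_inner:
  fixes A :: "real^'n^'n"
  shows "transpose A = A \<longleftrightarrow> (\<forall>x y. x \<bullet> (A *v y) = y \<bullet> (A *v x))"
proof
  assume sym: "transpose A = A"
  show "\<forall>x y. x \<bullet> (A *v y) = y \<bullet> (A *v x)"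
    by (metis sym dot_lmul_matrix inner_commute transpose_matrix_vector)
next
  assume bil: "\<forall>x y. x \<bullet> (A *v y) = y \<bullet> (A *v x)"
  have "transpose A *v x = A *v x" for x
  proof -
    have "\<forall>y. (transpose A *v x) \<bullet> y = (A *v x) \<bullet> y"
      using bil by (metis dot_lmul_matrix inner_commute transpose_matrix_vector)
    then show ?thesis by (simp add: vector_eq_rdot del: transpose_matrix_vector)
  qed
  then show "transpose A = A" by (simp add: matrix_eq)
qed

lemma inner_symmetric_matrix:
  fixes A :: "real^'n^'n"
  assumes "transpose A = A"
  shows "x \<bullet> (A *v y) = y \<bullet> (A *v x)"
  using transpose_eq_iff_inner[THEN iffD1, OF assms] by blast

lemma matrix_eq_iff_inner:
  fixes A B :: "real^'n^'m"
  shows "A = B \<longleftrightarrow> (\<forall>x y. x \<bullet> (A *v y) = x \<bullet> (B *v y))"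
  by (metis matrix_eq vector_eq_ldot)

lemma loewner_leI:
  assumes "transpose A = A" "transpose B = B" "\<And>x. x \<bullet> (A *v x) \<le> x \<bullet> (B *v x)"
  shows "loewner_le A B"
  using assms
  by (auto simp: loewner_le_def pos_semidef_def transpose_def vec_eq_iff
      matrix_vector_mult_diff_rdistrib inner_diff_right)

lemma loewner_leD: "loewner_le A B \<Longrightarrow> x \<bullet> (A *v x) \<le> x \<bullet> (B *v x)"
  by (simp add: loewner_le_def pos_semidef_def matrix_vector_mult_diff_rdistrib inner_diff_right)

lemma
  fixes A :: "'a::semiring_1^'n^'m"
  assumes "invertible A"
  shows matrix_inv_right: "A ** matrix_inv A = mat 1"
    and matrix_inv_left: "matrix_inv A ** A = mat 1"
  unfolding matrix_inv_def using someI_ex[OF assms[unfolded invertible_def]] by blast+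

lemma invertible_matrix_inv_vector:
  fixes A :: "'a::field^'n^'n"
  assumes "invertible A"
  shows "A *v (matrix_inv A *v x) = x"
  by (simp add: matrix_vector_mul_assoc matrix_inv_right[OF assms])

lemma transpose_matrix_inv:
  fixes A :: "real^'n^'n"
  assumes "invertible A" "transpose A = A"
  shows "transpose (matrix_inv A) = matrix_inv A"
  unfolding transpose_eq_iff_inner
proof (intro allI)
  fix x y
  show "x \<bullet> (matrix_inv A *v y) = y \<bullet> (matrix_inv A *v x)"
    using inner_symmetric_matrix[OF assms(2), of "matrix_inv A *v x" "matrix_inv A *v y"]
    unfolding invertible_matrix_inv_vector[OF assms(1)]
    by (simp add: inner_commute)
qed

lemma invertible_iff_ker:
  fixes A :: "'a::field^'n^'n"
  shows "invertible A \<longleftrightarrow> (\<forall>x. A *v x = 0 \<longrightarrow> x = 0)"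
  by (simp add: invertible_left_inverse matrix_left_invertible_ker)

lemma pos_def_invertible:
  assumes "pos_def A"
  shows "invertible A"
  using assms unfolding invertible_iff_ker pos_def_def by fastforce

text \<open>Expand the nonnegative form of \<open>A\<close> at the difference of \<open>u\<close>
  (solving \<open>A u = x\<close>) and \<open>w\<close> (solving \<open>B w = x\<close>). Its last
  term, \<open>w\<close> against \<open>A w\<close>, is at most \<open>w\<close> against
  \<open>B w\<close>, that is, \<open>x\<close> against \<open>w\<close>; what remains is the claim.
  No matrix square roots enter.\<close>

lemma loewner_le_matrix_inv:
  assumes A: "pos_def A" and B: "pos_def B" and le: "loewner_le A B"
  shows "loewner_le (matrix_inv B) (matrix_inv A)"
proof (rule loewner_leI)
  have symA: "transpose A = A" and symB: "transpose B = B"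
    using A B by (auto simp: pos_def_def)
  show "transpose (matrix_inv A) = matrix_inv A" "transpose (matrix_inv B) = matrix_inv B"
    using symA symB A B by (auto intro: transpose_matrix_inv pos_def_invertible)
  fix x
  define u where "u = matrix_inv A *v x"
  define w where "w = matrix_inv B *v x"
  have Au: "A *v u = x" and Bw: "B *v w = x"
    unfolding u_def w_def using A B by (simp_all add: invertible_matrix_inv_vector pos_def_invertible)
  have "0 \<le> (u - w) \<bullet> (A *v (u - w))"
    using A by (cases "u - w = 0") (auto simp: pos_def_def less_imp_le)
  also have "\<dots> = x \<bullet> u - 2 * (x \<bullet> w) + w \<bullet> (A *v w)"
    using inner_symmetric_matrix[OF symA, of u w]
    by (simp add: matrix_vector_mult_diff_distrib inner_diff_left inner_diff_right Au inner_commute)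
  also have "w \<bullet> (A *v w) \<le> x \<bullet> w"
    using loewner_leD[OF le, of w] by (simp add: Bw inner_commute)
  finally show "x \<bullet> (matrix_inv B *v x) \<le> x \<bullet> (matrix_inv A *v x)"
    by (simp add: u_def w_def)
qed

text \<open>A zero of a nonnegative form is a minimum. Moving from \<open>x\<close> by
  \<open>t\<close> along \<open>A x\<close> changes the form by a term linear in \<open>t\<close>
  with coefficient twice the squared norm of \<open>A x\<close>; a small negative \<open>t\<close>
  would make it negative unless \<open>A x\<close> vanishes.\<close>

lemma pos_semidef_inner_0D:
  assumes A: "pos_semidef A" and "x \<bullet> (A *v x) = 0"
  shows "A *v x = 0"
proof -
  let ?y = "A *v x"
  have sym: "transpose A = A" and nonneg: "\<And>z. 0 \<le> z \<bullet> (A *v z)"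
    using A by (auto simp: pos_semidef_def)
  have "0 \<le> 2 * t * (?y \<bullet> ?y) + t\<^sup>2 * (?y \<bullet> (A *v ?y))" for t
    using nonneg[of "x + t *\<^sub>R ?y"] inner_symmetric_matrix[OF sym, of x ?y] assms(2)
    by (simp add: matrix_vector_right_distrib matrix_vector_mult_scaleR inner_add_left
        inner_add_right power2_eq_square algebra_simps)
  note bound = this
  define b where "b = ?y \<bullet> (A *v ?y)"
  have b: "0 \<le> b" unfolding b_def by (rule nonneg)
  have "?y \<bullet> ?y \<le> 0"
  proof (rule ccontr)
    assume pos: "\<not> ?thesis"
    \<comment> \<open>The denominator \<open>b + 1\<close> stays positive even if
      \<open>b = 0\<close>. With this \<open>t\<close> the factor
      \<open>2 * (?y \<bullet> ?y) + t * b\<close> equals \<open>?y \<bullet> ?y - t\<close>, which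
      is positive, against the bound.\<close>
    define t where "t = - (?y \<bullet> ?y) / (b + 1)"
    have t: "t < 0" "t * (b + 1) = - (?y \<bullet> ?y)"
      using pos b by (auto simp: t_def field_simps)
    have "0 \<le> t * (2 * (?y \<bullet> ?y) + t * b)"
      using bound[of t] by (simp add: b_def power2_eq_square algebra_simps)
    then have "2 * (?y \<bullet> ?y) + t * b \<le> 0"
      using t(1) by (simp add: zero_le_mult_iff)
    moreover have "t * b = - (?y \<bullet> ?y) - t"
      using t(2) by (simp add: algebra_simps)
    ultimately show False using pos t(1) by linarith
  qed
  then show ?thesis using inner_gt_zero_iff not_le by blast
qed

text \<open>A kernel vector of \<open>B\<close> annihilates the smaller form of \<open>A\<close>,
  hence lies in the kernel of \<open>A\<close>. This carries invertibility of the amplitude block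
  from the MiLAC matrix to the digital one.\<close>

lemma invertible_loewner_mono:
  assumes A: "pos_semidef A" and inv: "invertible A" and le: "loewner_le A B"
  shows "invertible B"
  unfolding invertible_iff_ker
proof (intro allI impI)
  fix x assume "B *v x = 0"
  with loewner_leD[OF le, of x] have "x \<bullet> (A *v x) \<le> 0" by simp
  with A have "x \<bullet> (A *v x) = 0" by (simp add: pos_semidef_def antisym)
  then have "A *v x = 0" by (rule pos_semidef_inner_0D[OF A])
  with inv show "x = 0" by (simp add: invertible_iff_ker)
qed

section \<open>Angle and amplitude coordinates, and the Schur complement\<close>

definition join_vec :: "real^'a \<Rightarrow> real^'b \<Rightarrow> real^('a::finite + 'b::finite)" where
  "join_vec x y = (\<chi> p. case p of Inl i \<Rightarrow> x $ i | Inr j \<Rightarrow> y $ j)"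

lemma sum_UNIV_sum_type:
  fixes f :: "'a::finite + 'b::finite \<Rightarrow> 'c::comm_monoid_add"
  shows "sum f UNIV = (\<Sum>i\<in>UNIV. f (Inl i)) + (\<Sum>j\<in>UNIV. f (Inr j))"
  by (subst UNIV_Plus_UNIV[symmetric], subst sum.Plus) simp_all

lemma inner_join_vec: "join_vec x y \<bullet> join_vec u v = x \<bullet> u + y \<bullet> v"
  by (simp add: inner_vec_def join_vec_def sum_UNIV_sum_type)

lemma matrix_vector_mult_join_vec:
  "J *v join_vec x y = join_vec (block_\<theta>\<theta> J *v x + block_\<theta>\<beta> J *v y)
     (block_\<beta>\<theta> J *v x + block_\<beta>\<beta> J *v y)"
  by (auto simp: vec_eq_iff join_vec_def matrix_vector_mult_def sum_UNIV_sum_type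
      block_\<theta>\<theta>_def block_\<theta>\<beta>_def block_\<beta>\<theta>_def block_\<beta>\<beta>_def split: sum.split)

lemma inner_block_\<theta>\<beta>:
  assumes "transpose J = J"
  shows "x \<bullet> (block_\<theta>\<beta> J *v y) = y \<bullet> (block_\<beta>\<theta> J *v x)"
proof -
  have "transpose (block_\<beta>\<theta> J) = block_\<theta>\<beta> J"
    using assms by (auto simp: vec_eq_iff transpose_def block_\<theta>\<beta>_def block_\<beta>\<theta>_def)
  then show ?thesis
    by (metis dot_lmul_matrix inner_commute transpose_matrix_vector)
qed

lemma transpose_block_\<beta>\<beta>: "transpose J = J \<Longrightarrow> transpose (block_\<beta>\<beta> J) = block_\<beta>\<beta> J"
  by (simp add: vec_eq_iff transpose_def block_\<beta>\<beta>_def)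

text \<open>Vectors with zero angle part see only the amplitude block, which therefore inherits
  semidefiniteness and the Loewner order.\<close>

lemma inner_block_\<beta>\<beta>: "y \<bullet> (block_\<beta>\<beta> J *v y) = join_vec 0 y \<bullet> (J *v join_vec 0 y)"
  by (simp add: matrix_vector_mult_join_vec inner_join_vec)

lemma pos_semidef_block_\<beta>\<beta>: "pos_semidef J \<Longrightarrow> pos_semidef (block_\<beta>\<beta> J)"
  by (simp add: pos_semidef_def transpose_block_\<beta>\<beta> inner_block_\<beta>\<beta>)

lemma loewner_le_block_\<beta>\<beta>: "loewner_le A B \<Longrightarrow> loewner_le (block_\<beta>\<beta> A) (block_\<beta>\<beta> B)"
proof -
  have "block_\<beta>\<beta> B - block_\<beta>\<beta> A = block_\<beta>\<beta> (B - A)"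
    by (simp add: vec_eq_iff block_\<beta>\<beta>_def)
  then show "loewner_le A B \<Longrightarrow> loewner_le (block_\<beta>\<beta> A) (block_\<beta>\<beta> B)"
    by (simp add: loewner_le_def pos_semidef_block_\<beta>\<beta>)
qed

text \<open>Completing the square in the amplitude part \<open>y\<close>: the cross terms are
  absorbed by the shift \<open>m x\<close>, and the Schur complement is what is left over. If the
  amplitude block is semidefinite, \<open>m x\<close> minimizes over \<open>y\<close>.\<close>

lemma inner_join_vec_eq_marginal_fisher:
  fixes J :: "real^('k::finite) param^'k param"
  assumes sym: "transpose J = J" and inv: "invertible (block_\<beta>\<beta> J)"
  defines "m \<equiv> \<lambda>x. - (matrix_inv (block_\<beta>\<beta> J) *v (block_\<beta>\<theta> J *v x))"
  shows "join_vec x y \<bullet> (J *v join_vec x y)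
    = x \<bullet> (marginal_fisher J *v x) + (y - m x) \<bullet> (block_\<beta>\<beta> J *v (y - m x))"
proof -
  let ?C = "block_\<beta>\<beta> J" and ?D = "block_\<beta>\<theta> J" and ?E = "block_\<theta>\<beta> J"
  define w where "w = matrix_inv ?C *v (?D *v x)"
  have Cw: "?C *v w = ?D *v x"
    unfolding w_def by (rule invertible_matrix_inv_vector[OF inv])
  have S: "marginal_fisher J *v x = block_\<theta>\<theta> J *v x - ?E *v w"
    by (simp add: marginal_fisher_def w_def matrix_vector_mult_diff_rdistrib
        flip: matrix_vector_mul_assoc)
  have m: "y - m x = y + w" by (simp add: m_def w_def)
  have "w \<bullet> (?C *v y) = y \<bullet> (?D *v x)"
    using inner_symmetric_matrix[OF transpose_block_\<beta>\<beta>[OF sym], of w y] by (simp add: Cw)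
  then show ?thesis
    by (simp add: S m Cw matrix_vector_mult_join_vec inner_join_vec inner_add_left inner_add_right
        inner_diff_right matrix_vector_right_distrib inner_block_\<theta>\<beta>[OF sym])
qed

lemma loewner_le_marginal_fisher:
  assumes A: "pos_semidef A" and B: "transpose B = B" and le: "loewner_le A B"
    and inv: "invertible (block_\<beta>\<beta> A)"
    and S: "transpose (marginal_fisher A) = marginal_fisher A"
      "transpose (marginal_fisher B) = marginal_fisher B"
  shows "loewner_le (marginal_fisher A) (marginal_fisher B)"
proof (rule loewner_leI[OF S])
  fix x
  have symA: "transpose A = A" using A by (simp add: pos_semidef_def)
  have invB: "invertible (block_\<beta>\<beta> B)"
    using invertible_loewner_mono[OF pos_semidef_block_\<beta>\<beta>[OF A] inv loewner_le_block_\<beta>\<beta>[OF le]] .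
  \<comment> \<open>This is the minimizer for \<open>B\<close>: the square vanishes in the completed
    form of \<open>B\<close>, whereas in that of \<open>A\<close> it is merely nonnegative.\<close>
  define y where "y = - (matrix_inv (block_\<beta>\<beta> B) *v (block_\<beta>\<theta> B *v x))"
  have "x \<bullet> (marginal_fisher A *v x) \<le> join_vec x y \<bullet> (A *v join_vec x y)"
    using pos_semidef_block_\<beta>\<beta>[OF A]
    by (simp add: inner_join_vec_eq_marginal_fisher[OF symA inv] pos_semidef_def)
  also have "\<dots> \<le> join_vec x y \<bullet> (B *v join_vec x y)"
    by (rule loewner_leD[OF le])
  also have "\<dots> = x \<bullet> (marginal_fisher B *v x)"
    by (simp add: inner_join_vec_eq_marginal_fisher[OF B invB] y_def)
  finally show "x \<bullet> (marginal_fisher A *v x) \<le> x \<bullet> (marginal_fisher B *v x)" .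
qed

section \<open>Orthogonal projection onto the row space\<close>

text \<open>The inner product on \<open>complex^'n\<close> is the real part of the Hermitian form.\<close>

lemma inner_adjoint_matrix:
  fixes A :: "complex^'n^'m"
  shows "u \<bullet> (A *v w) = (adjoint_matrix A *v u) \<bullet> w"
proof -
  have "u \<bullet> (A *v w) = (\<Sum>i\<in>UNIV. \<Sum>j\<in>UNIV. Re (cnj (u $ i) * A $ i $ j * w $ j))"
    by (simp add: inner_vec_def matrix_vector_mult_def inner_complex_def sum_distrib_left
        algebra_simps flip: sum.distrib)
  also have "\<dots> = (\<Sum>j\<in>UNIV. \<Sum>i\<in>UNIV. Re (cnj (u $ i) * A $ i $ j * w $ j))"
    by (rule sum.swap)
  also have "\<dots> = (adjoint_matrix A *v u) \<bullet> w"
    by (simp add: inner_vec_def matrix_vector_mult_def inner_complex_def adjoint_matrix_def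
        transpose_def sum_distrib_left sum_distrib_right algebra_simps flip: sum.distrib)
  finally show ?thesis .
qed

lemma adjoint_adjoint_matrix [simp]: "adjoint_matrix (adjoint_matrix A) = A"
  by (simp add: adjoint_matrix_def transpose_def vec_eq_iff)

lemma adjoint_matrix_mult: "adjoint_matrix (A ** B) = adjoint_matrix B ** adjoint_matrix A"
  by (simp add: adjoint_matrix_def transpose_def vec_eq_iff matrix_matrix_mult_def mult.commute)

lemma adjoint_matrix_mat_1 [simp]: "adjoint_matrix (mat 1) = mat 1"
  by (auto simp: adjoint_matrix_def transpose_def vec_eq_iff mat_def)

text \<open>Taking adjoints turns a right inverse of the self-adjoint \<open>A\<close> into a left
  inverse, and the two one-sided inverses coincide.\<close>

lemma adjoint_matrix_inv:
  assumes "invertible A" "adjoint_matrix A = A"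
  shows "adjoint_matrix (matrix_inv A) = matrix_inv A"
proof -
  have "adjoint_matrix (matrix_inv A) ** A = mat 1"
    by (metis adjoint_matrix_mat_1 adjoint_matrix_mult assms matrix_inv_right)
  then show ?thesis
    by (metis assms(1) matrix_inv_right matrix_mul_assoc matrix_mul_lid matrix_mul_rid)
qed

text \<open>\<open>rows G\<close> is a set, in which equal rows collapse. Full rank forces it to
  have as many elements as there are indices, so the rows are distinct, and a spanning set of size
  equal to the dimension is independent. Injectivity then carries independence of the set to the
  indexed family.\<close>

lemma rank_full_imp_right_invertible:
  fixes G :: "'a::field^'n^'m"
  assumes "rank G = CARD('m)"
  shows "\<exists>B. G ** B = mat 1"
proof -
  have rows: "rows G = range (\<lambda>i. row i G)" by (auto simp: rows_def)
  then have fin: "finite (rows G)" by simp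
  have "card (rows G) \<le> CARD('m)" unfolding rows by (rule card_image_le) simp
  moreover have "vec.dim (rows G) \<le> card (rows G)" by (rule vec.dim_le_card'[OF fin])
  ultimately have card: "card (rows G) = CARD('m)" "vec.dim (rows G) = card (rows G)"
    using assms by (auto simp: row_rank_def_gen)
  then have inj: "inj (\<lambda>i. row i G)"
    unfolding rows by (intro eq_card_imp_inj_on) auto
  have indep: "vec.independent (rows G)"
    by (rule vec.card_le_dim_spanning[OF order_refl vec.span_superset fin])
      (simp add: card(2))
  show ?thesis
    unfolding matrix_right_invertible_independent_rows
  proof (intro allI impI)
    fix c :: "'m \<Rightarrow> 'a" and i
    assume z: "(\<Sum>i\<in>UNIV. c i *s row i G) = 0"
    let ?f = "\<lambda>i. row i G"
    have "(\<Sum>v\<in>rows G. c (inv ?f v) *s v) = 0"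
      unfolding rows by (simp add: sum.reindex[OF inj] inv_f_f[OF inj] z)
    then have "c (inv ?f (row i G)) = 0"
      by (rule vec.independentD[OF indep fin order_refl]) (auto simp: rows)
    then show "c i = 0" by (simp add: inv_f_f[OF inj])
  qed
qed

definition row_projection :: "complex^'n^'l \<Rightarrow> complex^'n^'n" where
  "row_projection G = adjoint_matrix G ** matrix_inv (G ** adjoint_matrix G) ** G"

text \<open>A kernel vector \<open>y\<close> of the Gram matrix makes the norm of
  \<open>adjoint_matrix G *v y\<close> zero. The adjoint of \<open>G\<close> is injective, since the
  adjoint of a right inverse of \<open>G\<close> is a left inverse of it.\<close>

lemma invertible_gram:
  fixes G :: "complex^'n^'l"
  assumes "rank G = CARD('l)"
  shows "invertible (G ** adjoint_matrix G)"
  unfolding invertible_iff_ker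
proof (intro allI impI)
  fix y assume y: "(G ** adjoint_matrix G) *v y = 0"
  obtain B where B: "G ** B = mat 1"
    using rank_full_imp_right_invertible[OF assms] by blast
  have "(adjoint_matrix G *v y) \<bullet> (adjoint_matrix G *v y) = y \<bullet> ((G ** adjoint_matrix G) *v y)"
    by (simp add: inner_adjoint_matrix flip: matrix_vector_mul_assoc)
  with y have "adjoint_matrix G *v y = 0" by simp
  moreover have "adjoint_matrix B ** adjoint_matrix G = mat 1"
    by (metis B adjoint_matrix_mat_1 adjoint_matrix_mult)
  ultimately show "y = 0"
    by (metis matrix_vector_mul_assoc matrix_vector_mul_lid matrix_vector_mult_0_right)
qed

lemma adjoint_row_projection:
  fixes G :: "complex^'n^'l"
  assumes "rank G = CARD('l)"
  shows "adjoint_matrix (row_projection G) = row_projection G"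
  using adjoint_matrix_inv[OF invertible_gram[OF assms]]
  by (simp add: row_projection_def adjoint_matrix_mult matrix_mul_assoc)

lemma row_projection_mult_adjoint:
  fixes G :: "complex^'n^'l"
  assumes "rank G = CARD('l)"
  shows "row_projection G ** adjoint_matrix G = adjoint_matrix G"
proof -
  have "row_projection G ** adjoint_matrix G
    = adjoint_matrix G ** (matrix_inv (G ** adjoint_matrix G) ** (G ** adjoint_matrix G))"
    by (simp add: row_projection_def matrix_mul_assoc)
  then show ?thesis by (simp add: matrix_inv_left[OF invertible_gram[OF assms]])
qed

lemma row_projection_idem:
  fixes G :: "complex^'n^'l"
  assumes "rank G = CARD('l)"
  shows "row_projection G ** row_projection G = row_projection G"
  by (subst (2 3) row_projection_def)
    (simp add: matrix_mul_assoc row_projection_mult_adjoint[OF assms])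

lemma matrix_vector_mult_axis_1:
  fixes A :: "'a::semiring_1^'n^'m"
  shows "A *v axis k 1 = column k A"
  by (simp add: vec_eq_iff matrix_vector_mult_def column_def axis_def if_distrib[of "(*) _"]
      cong: if_cong)

lemma row_space_eq_range:
  fixes G :: "complex^'n^'l"
  shows "row_space G = range ((*v) (adjoint_matrix G))"
proof
  have "columns A \<subseteq> range ((*v) A)" for A :: "complex^'b^'c"
    by (auto simp: columns_def simp flip: matrix_vector_mult_axis_1)
  then show "row_space G \<subseteq> range ((*v) (adjoint_matrix G))"
    unfolding row_space_def col_space_def
    by (intro vec.span_minimal vec.subspace_image vec.subspace_UNIV matrix_vector_mul_linear_gen)
  show "range ((*v) (adjoint_matrix G)) \<subseteq> row_space G"
  proof (rule image_subsetI)
    fix x :: "complex^'l"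
    have "column i (adjoint_matrix G) \<in> columns (adjoint_matrix G)" for i
      by (auto simp: columns_def)
    then show "adjoint_matrix G *v x \<in> row_space G"
      unfolding row_space_def col_space_def matrix_mult_sum
      by (intro vec.span_sum vec.span_scale vec.span_base)
  qed
qed

text \<open>The formula for the projection exhibits every value as an image under the adjoint of
  \<open>G\<close>, and the projection fixes all such images.\<close>

lemma row_projection_eq_iff:
  fixes G :: "complex^'n^'l"
  assumes "rank G = CARD('l)"
  shows "row_projection G *v z = z \<longleftrightarrow> z \<in> row_space G"
proof
  assume "row_projection G *v z = z"
  then have "z = adjoint_matrix G *v (matrix_inv (G ** adjoint_matrix G) *v (G *v z))"
    by (simp add: row_projection_def matrix_vector_mul_assoc matrix_mul_assoc)
  then show "z \<in> row_space G" unfolding row_space_eq_range by (rule range_eqI)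
next
  assume "z \<in> row_space G"
  then show "row_projection G *v z = z"
    unfolding row_space_eq_range
    by (auto simp: matrix_vector_mul_assoc row_projection_mult_adjoint[OF assms])
qed

section \<open>Block-diagonal action on stacked snapshots\<close>

text \<open>The identity factor makes the product block diagonal: snapshot \<open>t\<close> of the
  result is \<open>P\<close> applied to snapshot \<open>t\<close> of \<open>v\<close>.\<close>

lemma kronecker_mat_1_mult_nth:
  fixes P :: "'a::semiring_1^'n^'m" and v :: "'a^('t::finite \<times> 'n::finite)"
  shows "(kronecker_product (mat 1 :: 'a^'t^'t) P *v v) $ (t, i) = (P *v (\<chi> j. v $ (t, j))) $ i"
proof -
  have "(kronecker_product (mat 1 :: 'a^'t^'t) P *v v) $ (t, i)
    = (\<Sum>t'\<in>UNIV. \<Sum>j\<in>UNIV. (if t = t' then 1 else 0) * P $ i $ j * v $ (t', j))"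
    by (simp add: matrix_vector_mult_def kronecker_product_def mat_def sum.cartesian_product
        case_prod_beta flip: UNIV_Times_UNIV)
  also have "\<dots> = (\<Sum>t'\<in>UNIV. if t = t' then \<Sum>j\<in>UNIV. P $ i $ j * v $ (t', j) else 0)"
    by (rule sum.cong) auto
  finally show ?thesis by (simp add: matrix_vector_mult_def)
qed

lemma adjoint_kronecker_mat_1:
  "adjoint_matrix (kronecker_product (mat 1) P) = kronecker_product (mat 1) (adjoint_matrix P)"
  by (auto simp: adjoint_matrix_def transpose_def kronecker_product_def vec_eq_iff mat_def)

lemma kronecker_mat_1_mult_mult:
  fixes P Q :: "'a::semiring_1^'n^'n" and v :: "'a^('t::finite \<times> 'n::finite)"
  shows "kronecker_product (mat 1 :: 'a^'t^'t) P *v (kronecker_product (mat 1 :: 'a^'t^'t) Q *v v)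
    = kronecker_product (mat 1 :: 'a^'t^'t) (P ** Q) *v v"
  by (simp add: vec_eq_iff kronecker_mat_1_mult_nth flip: matrix_vector_mul_assoc)

lemma kronecker_mat_1_fixes_iff:
  fixes P :: "'a::semiring_1^'n^'n" and v :: "'a^('t::finite \<times> 'n::finite)"
  shows "kronecker_product (mat 1 :: 'a^'t^'t) P *v v = v
    \<longleftrightarrow> (\<forall>t. P *v (\<chi> i. v $ (t, i)) = (\<chi> i. v $ (t, i)))"
  by (simp add: vec_eq_iff kronecker_mat_1_mult_nth)

section \<open>The two information matrices\<close>

definition complex_vec :: "real^'n \<Rightarrow> complex^'n" where
  "complex_vec x = (\<chi> i. of_real (x $ i))"

lemma complex_vec_axis: "complex_vec (axis p 1) = axis p 1"
  by (simp add: complex_vec_def axis_def vec_eq_iff)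

text \<open>Real coefficients commute with \<open>Re\<close>, so a real form of
  \<open>map_matrix Re A\<close> becomes the real inner product of the complex vectors, to which
  adjoints apply.\<close>

lemma inner_map_matrix_Re:
  "x \<bullet> (map_matrix Re A *v y) = complex_vec x \<bullet> (A *v complex_vec y)"
  by (simp add: inner_vec_def matrix_vector_mult_def inner_complex_def complex_vec_def)

lemma inner_fisher_dig:
  "x \<bullet> (fisher_dig a s \<sigma> \<xi> *v y) = 2 / \<sigma>\<^sup>2 *
     ((stacked_jacobian a s \<xi> *v complex_vec x) \<bullet> (stacked_jacobian a s \<xi> *v complex_vec y))"
  by (simp add: fisher_dig_def scaleR_matrix_vector_assoc[symmetric] inner_map_matrix_Re
      inner_adjoint_matrix flip: matrix_vector_mul_assoc)

lemma inner_fisher_milac: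
  "x \<bullet> (fisher_milac a s \<sigma> G \<xi> *v y) = 2 / \<sigma>\<^sup>2 *
     ((stacked_jacobian a s \<xi> *v complex_vec x) \<bullet>
      (kronecker_product (mat 1) (row_projection G) *v (stacked_jacobian a s \<xi> *v complex_vec y)))"
  unfolding fisher_milac_def row_projection_def[symmetric]
  by (simp add: scaleR_matrix_vector_assoc[symmetric] inner_map_matrix_Re
      flip: matrix_vector_mul_assoc) (simp add: inner_adjoint_matrix)

context
  fixes G :: "complex^'n^'l"
    and W :: "complex^('t::finite \<times> 'n::finite)^('t::finite \<times> 'n::finite)"
  assumes rank: "rank G = CARD('l)"
  defines "W \<equiv> kronecker_product (mat 1) (row_projection G)"
begin

text \<open>\<open>W\<close> inherits self-adjointness and idempotence blockwise from the row
  projection.\<close>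

lemma inner_stacked_projection: "u \<bullet> (W *v v) = (W *v u) \<bullet> (W *v v)"
proof -
  have "W *v (W *v v) = W *v v"
    unfolding W_def by (simp add: kronecker_mat_1_mult_mult row_projection_idem[OF rank])
  moreover have "adjoint_matrix W = W"
    unfolding W_def by (simp add: adjoint_kronecker_mat_1 adjoint_row_projection[OF rank])
  ultimately show ?thesis
    by (metis inner_adjoint_matrix)
qed

lemma inner_diff_stacked_projection: "v \<bullet> v - v \<bullet> (W *v v) = (v - W *v v) \<bullet> (v - W *v v)"
  using inner_stacked_projection[of v v]
  by (simp add: inner_diff_left inner_diff_right inner_commute)

end

section \<open>Loewner comparison and the case of equality\<close>

lemma transpose_fisher_dig: "transpose (fisher_dig a s \<sigma> \<xi>) = fisher_dig a s \<sigma> \<xi>"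
  by (simp add: transpose_eq_iff_inner inner_fisher_dig inner_commute)

lemma pos_semidef_fisher_milac:
  fixes G :: "complex^'n^'l"
  assumes "rank G = CARD('l)"
  shows "pos_semidef (fisher_milac a s \<sigma> G \<xi>)"
proof -
  let ?v = "\<lambda>x. stacked_jacobian a s \<xi> *v complex_vec x"
    and ?W = "kronecker_product (mat 1) (row_projection G)"
  have "x \<bullet> (fisher_milac a s \<sigma> G \<xi> *v y) = 2 / \<sigma>\<^sup>2 * ((?W *v ?v x) \<bullet> (?W *v ?v y))" for x y
    unfolding inner_fisher_milac
    using inner_stacked_projection[OF assms, of "?v x" "?v y"] by (rule arg_cong)
  then show ?thesis
    by (simp add: pos_semidef_def transpose_eq_iff_inner inner_commute)
qed

text \<open>Pythagoras: the information lost in direction \<open>x\<close> is the energy of the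
  component of \<open>v x\<close> removed by the projection. Its sign gives the Loewner order and
  its vanishing the case of equality.\<close>

lemma inner_fisher_diff:
  fixes G :: "complex^'n^'l" and a s \<xi>
  assumes "rank G = CARD('l)"
  defines "v \<equiv> \<lambda>x. stacked_jacobian a s \<xi> *v complex_vec x"
  shows "x \<bullet> (fisher_dig a s \<sigma> \<xi> *v x) - x \<bullet> (fisher_milac a s \<sigma> G \<xi> *v x)
    = 2 / \<sigma>\<^sup>2 * (norm (v x - kronecker_product (mat 1) (row_projection G) *v v x))\<^sup>2"
  unfolding inner_fisher_dig inner_fisher_milac power2_norm_eq_inner v_def
    inner_diff_stacked_projection[OF assms(1), symmetric]
  by (simp add: algebra_simps)

lemma loewner_le_fisher:
  fixes G :: "complex^'n^'l"
  assumes "rank G = CARD('l)"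
  shows "loewner_le (fisher_milac a s \<sigma> G \<xi>) (fisher_dig a s \<sigma> \<xi>)"
proof (rule loewner_leI[OF _ transpose_fisher_dig])
  show "transpose (fisher_milac a s \<sigma> G \<xi>) = fisher_milac a s \<sigma> G \<xi>"
    using pos_semidef_fisher_milac[OF assms, of a s \<sigma> \<xi>] by (simp add: pos_semidef_def)
  fix x
  have "0 \<le> x \<bullet> (fisher_dig a s \<sigma> \<xi> *v x) - x \<bullet> (fisher_milac a s \<sigma> G \<xi> *v x)"
    unfolding inner_fisher_diff[OF assms] by simp
  then show "x \<bullet> (fisher_milac a s \<sigma> G \<xi> *v x) \<le> x \<bullet> (fisher_dig a s \<sigma> \<xi> *v x)"
    by simp
qed

text \<open>Zero loss along each coordinate vector already says that the block projection fixes each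
  column of \<open>M\<close>. Fixing all columns fixes the whole range of \<open>M\<close>, so the
  two bilinear forms agree.\<close>

lemma fisher_eq_iff_fixes_columns:
  fixes G :: "complex^'n^'l" and a s \<xi>
  assumes rank: "rank G = CARD('l)" and \<sigma>: "\<sigma>\<^sup>2 > 0"
  defines "M \<equiv> stacked_jacobian a s \<xi>"
  shows "fisher_milac a s \<sigma> G \<xi> = fisher_dig a s \<sigma> \<xi>
    \<longleftrightarrow> (\<forall>p t. (\<chi> i. M $ (t, i) $ p) \<in> row_space G)"
proof -
  let ?W = "kronecker_product (mat 1) (row_projection G)"
  have cols: "?W *v column p M = column p M \<longleftrightarrow> (\<forall>t. (\<chi> i. M $ (t, i) $ p) \<in> row_space G)" for p
    by (simp add: kronecker_mat_1_fixes_iff row_projection_eq_iff[OF rank] column_def)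
  have "fisher_milac a s \<sigma> G \<xi> = fisher_dig a s \<sigma> \<xi> \<longleftrightarrow> (\<forall>p. ?W *v column p M = column p M)"
  proof
    assume eq: "fisher_milac a s \<sigma> G \<xi> = fisher_dig a s \<sigma> \<xi>"
    show "\<forall>p. ?W *v column p M = column p M"
    proof
      fix p
      show "?W *v column p M = column p M"
        using inner_fisher_diff[OF rank, of "axis p 1" a s \<sigma> \<xi>] eq \<sigma>
        by (auto simp: complex_vec_axis M_def matrix_vector_mult_axis_1)
    qed
  next
    assume fixed: "\<forall>p. ?W *v column p M = column p M"
    have "?W ** M = M"
    proof -
      have "column p (?W ** M) = column p M" for p
        using fixed by (simp flip: matrix_vector_mult_axis_1 matrix_vector_mul_assoc)
      then show ?thesis by (simp add: column_def vec_eq_iff)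
    qed
    then have "?W *v (M *v z) = M *v z" for z
      by (simp add: matrix_vector_mul_assoc)
    then show "fisher_milac a s \<sigma> G \<xi> = fisher_dig a s \<sigma> \<xi>"
      by (simp add: matrix_eq_iff_inner inner_fisher_milac inner_fisher_dig M_def)
  qed
  with cols show ?thesis by simp
qed

text \<open>Each snapshot of a Jacobian column is a scalar multiple of some steering vector or its
  derivative. Where the scalar is nonzero, membership in the row space passes both ways.\<close>

lemma fisher_eq_iff_signal_subspace:
  fixes a :: "real \<Rightarrow> complex^'n" and G :: "complex^'n^'l" and \<beta> :: "complex^'k"
  assumes rank: "rank G = CARD('l)" and \<sigma>: "\<sigma>\<^sup>2 > 0"
    and diff: "\<And>x. a differentiable (at x)" and \<beta>: "\<And>k. \<beta> $ k \<noteq> 0" and s: "s \<noteq> 0"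
  shows "fisher_milac a s \<sigma> G (param_vector \<theta> \<beta>) = fisher_dig a s \<sigma> (param_vector \<theta> \<beta>)
    \<longleftrightarrow> signal_subspace a \<theta> \<subseteq> row_space G"
proof -
  let ?M = "stacked_jacobian a s (param_vector \<theta> \<beta>)"
  have sub: "vec.subspace (row_space G)"
    by (simp add: row_space_def col_space_def)
  have scale: "c *s z \<in> row_space G \<longleftrightarrow> z \<in> row_space G" if "c \<noteq> 0" for c z
  proof
    assume "c *s z \<in> row_space G"
    then have "inverse c *s (c *s z) \<in> row_space G" by (rule vec.subspace_scale[OF sub])
    with that show "z \<in> row_space G" by simp
  qed (rule vec.subspace_scale[OF sub])
  have angle_col: "(\<chi> i. ?M $ (t, i) $ Inl k) = (s $ t * \<beta> $ k) *s vector_derivative a (at (\<theta> $ k))" for t k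
    by (simp add: vec_eq_iff stacked_jacobian_angle[OF diff])
  have amplitude_col: "(\<chi> i. ?M $ (t, i) $ Inr (k, b)) = ((if b then \<i> else 1) * s $ t) *s a (\<theta> $ k)" for t k b
    by (simp add: vec_eq_iff stacked_jacobian_amplitude)
  \<comment> \<open>A single snapshot with nonzero waveform recovers all generators; at snapshots
    where the waveform is zero the columns vanish and lie in any subspace.\<close>
  obtain t0 where t0: "s $ t0 \<noteq> 0" using s by (auto simp: vec_eq_iff)
  have "(\<forall>p t. (\<chi> i. ?M $ (t, i) $ p) \<in> row_space G)
    \<longleftrightarrow> (\<forall>k. a (\<theta> $ k) \<in> row_space G \<and> vector_derivative a (at (\<theta> $ k)) \<in> row_space G)"
  proof (intro iffI allI conjI)
    fix k
    assume all: "\<forall>p t. (\<chi> i. ?M $ (t, i) $ p) \<in> row_space G"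
    show "a (\<theta> $ k) \<in> row_space G"
      using all[rule_format, of t0 "Inr (k, False)"] t0 by (simp add: amplitude_col scale)
    show "vector_derivative a (at (\<theta> $ k)) \<in> row_space G"
      using all[rule_format, of t0 "Inl k"] t0 \<beta> by (simp add: angle_col scale)
  next
    fix p t
    assume gen: "\<forall>k. a (\<theta> $ k) \<in> row_space G \<and> vector_derivative a (at (\<theta> $ k)) \<in> row_space G"
    show "(\<chi> i. ?M $ (t, i) $ p) \<in> row_space G"
    proof (cases p)
      case (Inl k)
      then show ?thesis using gen by (simp add: angle_col vec.subspace_scale[OF sub])
    next
      case (Inr q)
      then show ?thesis
        using gen by (cases q) (simp only: amplitude_col vec.subspace_scale[OF sub])
    qed
  qed
  also have "\<dots> \<longleftrightarrow> signal_subspace a \<theta> \<subseteq> row_space G"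
  proof -
    let ?S = "\<Union>k. {a (\<theta> $ k), vector_derivative a (at (\<theta> $ k))}"
    have "vec.span ?S \<subseteq> row_space G \<longleftrightarrow> ?S \<subseteq> row_space G"
      using vec.span_minimal[OF _ sub, of ?S] vec.span_superset[of ?S] by (meson order_trans)
    then show ?thesis by (auto simp: signal_subspace_def)
  qed
  finally show ?thesis
    by (simp add: fisher_eq_iff_fixes_columns[OF rank \<sigma>])
qed

theorem theorem2:
  fixes a :: "real \<Rightarrow> complex^'n"
    and \<theta> :: "real^'k"
    and \<beta> :: "complex^'k"
    and s :: "complex^'t"
    and \<sigma> :: real
    and G :: "complex^'n^'l"
  assumes "CARD('l) \<le> CARD('n)"
    and "\<And>x. a differentiable (at x)"
    and "inj (\<lambda>k. \<theta> $ k)"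
    and "\<And>k. \<beta> $ k \<noteq> 0"
    and "s \<noteq> 0"
    and "\<sigma>\<^sup>2 > 0"
    and "2 * CARD('k) \<le> CARD('n)"
    and "vec.dim (signal_subspace a \<theta>) = 2 * CARD('k)"
    and "rank G = CARD('l)"
  shows "loewner_le (fisher_milac a s \<sigma> G (param_vector \<theta> \<beta>))
                    (fisher_dig a s \<sigma> (param_vector \<theta> \<beta>))
    \<and> (invertible (block_\<beta>\<beta> (fisher_milac a s \<sigma> G (param_vector \<theta> \<beta>)))
         \<and> pos_def (marginal_fisher (fisher_milac a s \<sigma> G (param_vector \<theta> \<beta>)))
         \<and> pos_def (marginal_fisher (fisher_dig a s \<sigma> (param_vector \<theta> \<beta>)))
       \<longrightarrow> loewner_le (crb (fisher_dig a s \<sigma> (param_vector \<theta> \<beta>)))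
                      (crb (fisher_milac a s \<sigma> G (param_vector \<theta> \<beta>))))
    \<and> (fisher_milac a s \<sigma> G (param_vector \<theta> \<beta>) = fisher_dig a s \<sigma> (param_vector \<theta> \<beta>)
       \<longleftrightarrow> signal_subspace a \<theta> \<subseteq> row_space G)"
proof (intro conjI impI)
  let ?M = "fisher_milac a s \<sigma> G (param_vector \<theta> \<beta>)"
    and ?D = "fisher_dig a s \<sigma> (param_vector \<theta> \<beta>)"
  show le: "loewner_le ?M ?D"
    by (rule loewner_le_fisher[OF assms(9)])
  show "?M = ?D \<longleftrightarrow> signal_subspace a \<theta> \<subseteq> row_space G"
    by (rule fisher_eq_iff_signal_subspace[OF assms(9,6,2,4,5)])
  assume "invertible (block_\<beta>\<beta> ?M) \<and> pos_def (marginal_fisher ?M) \<and> pos_def (marginal_fisher ?D)"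
  then show "loewner_le (crb ?D) (crb ?M)"
    \<comment> \<open>Monotonicity of the Schur complement orders the marginal matrices, and
      inversion reverses that order. The symmetry premises come from \<open>pos_def\<close>.\<close>
    unfolding crb_def
    by (intro loewner_le_matrix_inv loewner_le_marginal_fisher pos_semidef_fisher_milac
        transpose_fisher_dig le assms(9)) (auto simp: pos_def_def)
qed

end
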